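(* There exists a universal constant $c\in(0,1]$ such that the $c$-thinned $e^{-c}$-quantile share is universally feasible; that is, for all integers $n\ge 2$ and $m\ge 1$ and all monotone valuations $v_1,\dots,v_n$ on $[m]$, there is an allocation $(S_1,\dots,S_n)$ of $[m]$ with $v_i(S_i)\ge \tau^{(c)}_{e^{-c}}(v_i,n)$ for every $i\in[n]$.
   Context: Let $[m]=\{1,\dots,m\}$ be a set of indivisible goods and $n\ge 2$ the number of agents. A monotone valuation on $[m]$ is a function $v:2^{[m]}\to\mathbb{R}_{\ge 0}$ with $v(\emptyset)=0$ and $v(A)\le v(B)$ whenever $A\subseteq B$. An allocation is an $n$-tuple $(S_1,\dots,S_n)$ of pairwise disjoint (possibly empty) subsets of $[m]$ whose union is $[m]$. For $c\in(0,1]$, the $c$-thinned random bundle $X^{(c)}\subseteq[m]$ is obtained by including each good independently with probability $c/n$. For $q\in(0,1)$, the $c$-thinned $q$-quantile share is $\tau_q^{(c)}(v,n):=\min\{t\in v(2^{[m]}):\mathbb{P}[v(X^{(c)})\le t]\ge q\}$. A share $\tau$ is universally feasible if for every profile $(v_1,\dots,v_n)$ of monotone valuations (any number of agents $n\ge 2$, any finite set of goods) there is an allocation $(S_1,\dots,S_n)$ with $v_i(S_i)\ge\tau(v_i,n)$ for all $i\in[n]$. *)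

theory Defs
  imports "HOL-Probability.Probability"
begin

text \<open>The goods are \<open>{1..m}\<close> and the agents are \<open>{1..n}\<close>.  A valuation is a total function on
  sets of naturals, of which only the values on subsets of \<open>{1..m}\<close> are constrained or used.\<close>

definition monotone_valuation :: "nat \<Rightarrow> (nat set \<Rightarrow> real) \<Rightarrow> bool" where
  "monotone_valuation m v \<longleftrightarrow>
     (\<forall>A \<in> Pow {1..m}. v A \<ge> 0) \<and> v {} = 0 \<and> mono_on (Pow {1..m}) v"

definition allocation :: "nat \<Rightarrow> nat \<Rightarrow> (nat \<Rightarrow> nat set) \<Rightarrow> bool" where
  "allocation m n S \<longleftrightarrow> disjoint_family_on S {1..n} \<and> (\<Union>i\<in>{1..n}. S i) = {1..m}"

definition thinned_bundle :: "real \<Rightarrow> nat \<Rightarrow> nat \<Rightarrow> nat set pmf" where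
  "thinned_bundle c m n =
     map_pmf (\<lambda>b. {j \<in> {1..m}. b j}) (Pi_pmf {1..m} False (\<lambda>_. bernoulli_pmf (c / real n)))"

text \<open>For \<open>q < 1\<close> and monotone \<open>v\<close>, the set under the minimum is finite and contains
  \<open>v {1..m}\<close>.\<close>

definition thinned_quantile_share ::
    "real \<Rightarrow> real \<Rightarrow> nat \<Rightarrow> (nat set \<Rightarrow> real) \<Rightarrow> nat \<Rightarrow> real" where
  "thinned_quantile_share c q m v n =
     Min {t \<in> v ` Pow {1..m}. measure_pmf.prob (thinned_bundle c m n) {X. v X \<le> t} \<ge> q}"

text \<open>A share maps the number \<open>m\<close> of goods, a valuation on \<open>{1..m}\<close> and the number \<open>n\<close> of
  agents to a real; \<open>m\<close> is explicit because it is not determined by the total function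
  representing the valuation.\<close>

definition universally_feasible :: "(nat \<Rightarrow> (nat set \<Rightarrow> real) \<Rightarrow> nat \<Rightarrow> real) \<Rightarrow> bool" where
  "universally_feasible \<tau> \<longleftrightarrow>
     (\<forall>n\<ge>2. \<forall>m\<ge>1. \<forall>v :: nat \<Rightarrow> nat set \<Rightarrow> real.
        (\<forall>i\<in>{1..n}. monotone_valuation m (v i)) \<longrightarrow>
        (\<exists>S. allocation m n S \<and> (\<forall>i\<in>{1..n}. v i (S i) \<ge> \<tau> m (v i) n)))"

end

theory Submission
  imports Defs
begin

text \<open>
  Let \<open>p = c / n\<close> and let \<open>F i\<close> be the family of the bundles that agent \<open>i\<close> values at least at the
  share. It is closed under supersets, and the random bundle lies in it with probability greater
  than \<open>1 - exp (- c)\<close>. What is needed are pairwise disjoint sets \<open>S i \<in> F i\<close>. A family of sets that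
  meet a fixed set of \<open>n - 1\<close> goods shows how tight this is: the same \<open>n - 1\<close> goods cannot serve all
  agents, but its probability \<open>1 - (1 - p) ^ (n - 1)\<close> is smaller than \<open>1 - exp (- c)\<close>, by about \<open>p\<close>
  if \<open>c\<close> is small. This narrow margin is what the proof has to live on.

  Compressing all families simultaneously towards small goods changes neither the
  probabilities nor, in the direction that matters, the existence of disjoint representatives
  (\<open>rainbow_by_reduction_to_left_shifted\<close>). A compressed family that contains a set \<open>A\<close> contains every
  set that dominates \<open>A\<close>, that is, has at least as many elements as \<open>A\<close> in every initial segment
  (\<open>shifted_dominated\<close>). An arithmetic progression of difference \<open>d\<close> dominates every set that is
  sparse relative to \<open>1 / d\<close>, and progressions are easily made disjoint. So the problem reduces to
  showing that every family contains a sufficiently sparse set.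

  Choose \<open>L\<close> maximal such that \<open>L\<close> agents can be served by one good each out of \<open>1, \<dots>, L\<close>, together
  with a progression of difference \<open>2 * n\<close>. The remaining \<open>k = n - L\<close> agents share what is left in
  progressions of the smaller difference \<open>2 * k\<close> (\<open>rainbow_if_uncrowded\<close>). If this fails for one of
  them, then by maximality every set in its family either meets \<open>{1..L}\<close> or is too dense for
  both constructions. A union bound shows that the latter has probability at most a multiple of
  \<open>c * (k * p)\<close>, so it is at most \<open>k * p / 4\<close> once \<open>c\<close> is small (\<open>prob_crowded_le\<close>). On the other hand
  \<open>(1 - p) ^ L\<close> exceeds \<open>exp (- c)\<close> by at least \<open>k * p / 4\<close> (\<open>exp_plus_gap_le_power\<close>). Hence the family
  has probability at most \<open>1 - exp (- c)\<close>, a contradiction.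
\<close>

section \<open>Left-shifted families and domination\<close>

definition up_closed :: "'a set \<Rightarrow> 'a set set \<Rightarrow> bool" where
  "up_closed V F \<longleftrightarrow> F \<subseteq> Pow V \<and> (\<forall>A\<in>F. \<forall>B. A \<subseteq> B \<and> B \<subseteq> V \<longrightarrow> B \<in> F)"

lemma up_closedD: "up_closed V F \<Longrightarrow> A \<in> F \<Longrightarrow> A \<subseteq> B \<Longrightarrow> B \<subseteq> V \<Longrightarrow> B \<in> F"
  by (auto simp: up_closed_def)

lemma up_closed_subset: "up_closed V F \<Longrightarrow> A \<in> F \<Longrightarrow> A \<subseteq> V"
  by (auto simp: up_closed_def)

text \<open>The name is that of matchings in hypergraphs whose colour classes are the given families.\<close>

definition rainbow :: "'i set \<Rightarrow> ('i \<Rightarrow> 'a set set) \<Rightarrow> bool" where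
  "rainbow I F \<longleftrightarrow> (\<exists>S. (\<forall>i\<in>I. S i \<in> F i) \<and> disjoint_family_on S I)"

definition left_shifted :: "nat set \<Rightarrow> nat set set \<Rightarrow> bool" where
  "left_shifted V F \<longleftrightarrow>
     (\<forall>A\<in>F. \<forall>x\<in>V. \<forall>y. x < y \<and> y \<in> A \<and> x \<notin> A \<longrightarrow> insert x (A - {y}) \<in> F)"

text \<open>The initial-segment counts say that the \<open>i\<close>-th smallest element of \<open>B\<close> is at most the
  \<open>i\<close>-th smallest element of \<open>A\<close>. The set \<open>A\<close> is moved into \<open>B\<close> one element at a time, by shifts
  that keep the domination by \<open>B\<close>; the closure under supersets supplies the rest of \<open>B\<close>.\<close>

lemma shifted_dominated:
  assumes F: "up_closed V F" "left_shifted V F" and "finite V"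
    and "A \<in> F" "B \<subseteq> V" "\<And>t. card (A \<inter> {..t}) \<le> card (B \<inter> {..t})"
  shows "B \<in> F"
  using assms(4-)
proof (induction "card (A - B)" arbitrary: A rule: less_induct)
  case less
  have finA: "finite A" using up_closed_subset[OF F(1) less.prems(1)] assms(3) finite_subset by blast
  have finB: "finite B" using less.prems(2) assms(3) finite_subset by blast
  show ?case
  proof (cases "A \<subseteq> B")
    case True
    then show ?thesis using up_closedD[OF F(1) less.prems(1)] less.prems(2) by blast
  next
    case False
    define a where "a = Min (A - B)"
    have a: "a \<in> A" "a \<notin> B" using False finA Min_in[of "A - B"] unfolding a_def by auto
    have amin: "z \<in> B" if "z \<in> A" "z < a" for z
    proof (rule ccontr)
      assume "z \<notin> B"
      then have "a \<le> z" using that finA unfolding a_def by (intro Min_le) auto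
      then show False using that by simp
    qed
    have "\<not> B \<inter> {..a} \<subseteq> A"
    proof
      assume "B \<inter> {..a} \<subseteq> A"
      then have "B \<inter> {..a} \<subset> A \<inter> {..a}" using a by auto
      then have "card (B \<inter> {..a}) < card (A \<inter> {..a})" using finA by (intro psubset_card_mono) auto
      then show False using less.prems(3)[of a] by simp
    qed
    then obtain b where b: "b \<in> B" "b \<le> a" "b \<notin> A" by auto
    with a have "b < a" by (metis le_neq_implies_less)
    (* As a is the first element of A outside B, the segments of the new set before a lie in B,
       and those from a on keep their sizes. *)
    define A' where "A' = insert b (A - {a})"
    have "A' \<in> F" using F(2) less.prems(1,2) b a \<open>b < a\<close> unfolding left_shifted_def A'_def by blast
    moreover have "A' - B \<subset> A - B" using a b unfolding A'_def by auto
    then have "card (A' - B) < card (A - B)" using finA by (intro psubset_card_mono) auto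
    moreover have "card (A' \<inter> {..t}) \<le> card (B \<inter> {..t})" for t
    proof (cases "t < a")
      case True
      then have "A' \<inter> {..t} \<subseteq> B \<inter> {..t}" using amin b unfolding A'_def by auto
      then show ?thesis using finB by (intro card_mono) auto
    next
      case False
      then have "A' \<inter> {..t} = insert b ((A \<inter> {..t}) - {a})" using b unfolding A'_def by auto
      moreover have "card (insert b ((A \<inter> {..t}) - {a})) = card (A \<inter> {..t})"
        using a b finA False card_Suc_Diff1[of "A \<inter> {..t}" a] by simp
      ultimately show ?thesis using less.prems(3)[of t] by simp
    qed
    ultimately show ?thesis using less.hyps[of A'] less.prems(2) by blast
  qed
qed

text \<open>In the form used below the dominating set may be infinite: the counts are only affected by
  elements up to \<open>m\<close>, where \<open>A\<close> lives.\<close>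

lemma shifted_dominated_truncated:
  assumes F: "up_closed {1..m} F" "left_shifted {1..m} F" "A \<in> F"
    and B: "0 \<notin> B" "\<And>t. card (A \<inter> {..t}) \<le> card (B \<inter> {..t})"
  shows "{1..m} \<inter> B \<in> F"
proof (rule shifted_dominated[OF F(1,2) _ F(3)])
  show "card (A \<inter> {..t}) \<le> card ({1..m} \<inter> B \<inter> {..t})" for t
  proof -
    have "A \<inter> {..t} = A \<inter> {..min t m}" using up_closed_subset[OF F(1,3)] by auto
    moreover have "{1..m} \<inter> B \<inter> {..t} = B \<inter> {..min t m}" using B(1) by (auto simp: Suc_le_eq intro: gr0I)
    ultimately show ?thesis using B(2)[of "min t m"] by simp
  qed
qed auto

section \<open>Compressing all families simultaneously\<close>

text \<open>This is the classical shifting operator of extremal set theory.\<close>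

definition shift_set :: "'a \<Rightarrow> 'a \<Rightarrow> 'a set set \<Rightarrow> 'a set \<Rightarrow> 'a set" where
  "shift_set x y F A =
     (if y \<in> A \<and> x \<notin> A \<and> insert x (A - {y}) \<notin> F then insert x (A - {y}) else A)"

definition left_shift :: "'a \<Rightarrow> 'a \<Rightarrow> 'a set set \<Rightarrow> 'a set set" where
  "left_shift x y F = shift_set x y F ` F"

lemma swap_back: "y \<in> A \<Longrightarrow> x \<notin> A \<Longrightarrow> insert y (insert x (A - {y}) - {x}) = A"
  by auto

text \<open>Thanks to injectivity, sums over a compressed family are sums over the original one.\<close>

lemma inj_on_shift_set: "inj_on (shift_set x y F) F"
proof (rule inj_onI)
  fix A B assume *: "A \<in> F" "B \<in> F" "shift_set x y F A = shift_set x y F B"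
  show "A = B"
  proof (cases "shift_set x y F A = A \<or> shift_set x y F B = B")
    case True
    with * show ?thesis by (auto simp: shift_set_def split: if_splits)
  next
    case False
    then have "y \<in> A" "x \<notin> A" "y \<in> B" "x \<notin> B" "insert x (A - {y}) = insert x (B - {y})"
      using *(3) by (auto simp: shift_set_def split: if_splits)
    then show ?thesis by (metis swap_back)
  qed
qed

text \<open>In terms of pairs of sets that arise from each other by exchanging \<open>x\<close> and \<open>y\<close>, a compressed
  family depends monotonically on the original one. This is why closure under supersets survives
  the compression.\<close>

lemma mem_left_shift_iff:
  assumes "x \<noteq> y"
  shows "A \<in> left_shift x y F \<longleftrightarrow>
    (if x \<in> A \<and> y \<notin> A then A \<in> F \<or> insert y (A - {x}) \<in> F
     else if y \<in> A \<and> x \<notin> A then A \<in> F \<and> insert x (A - {y}) \<in> F else A \<in> F)"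
    (is "?l \<longleftrightarrow> ?r")
proof
  assume ?l
  then obtain B where B: "B \<in> F" "A = shift_set x y F B" by (auto simp: left_shift_def)
  show ?r
  proof (cases "y \<in> B \<and> x \<notin> B \<and> insert x (B - {y}) \<notin> F")
    case True
    then have "A = insert x (B - {y})" using B by (simp add: shift_set_def)
    then have "x \<in> A" "y \<notin> A" "insert y (A - {x}) = B" using assms True by auto
    then show ?thesis using B by simp
  next
    case False
    then have "A = B" using B(2) unfolding shift_set_def by argo
    then show ?thesis using False B(1) by (metis (full_types))
  qed
next
  assume r: ?r
  show ?l
  proof (cases "A \<in> F")
    case True
    then have "\<not> (y \<in> A \<and> x \<notin> A \<and> insert x (A - {y}) \<notin> F)" using r by (metis (full_types))
    then have "shift_set x y F A = A" unfolding shift_set_def by argo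
    then show ?thesis using True unfolding left_shift_def by (metis imageI)
  next
    case False
    then have *: "x \<in> A" "y \<notin> A" "insert y (A - {x}) \<in> F" using r by (metis (full_types))+
    have "insert x (insert y (A - {x}) - {y}) = A" using * by auto
    then have "shift_set x y F (insert y (A - {x})) = A" using False * assms
      unfolding shift_set_def by auto
    then show ?thesis using * unfolding left_shift_def by (metis imageI)
  qed
qed

lemma up_closed_left_shift:
  assumes F: "up_closed V F" and xy: "x \<in> V" "y \<in> V" "x \<noteq> y"
  shows "up_closed V (left_shift x y F)"
  unfolding up_closed_def
proof (intro conjI ballI allI impI)
  show "left_shift x y F \<subseteq> Pow V"
  proof
    fix A assume "A \<in> left_shift x y F"
    then show "A \<in> Pow V" using up_closed_subset[OF F] xy
      by (fastforce simp: left_shift_def shift_set_def split: if_splits)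
  qed
  fix A B assume A: "A \<in> left_shift x y F" and B: "A \<subseteq> B \<and> B \<subseteq> V"
  have up: "D \<in> F" if "C \<in> F" "C \<subseteq> D" "D \<subseteq> V" for C D using up_closedD[OF F] that by blast
  have V: "insert x (B - {y}) \<subseteq> V" "insert y (B - {x}) \<subseteq> V" using B xy by auto
  have m: "x \<notin> A \<or> y \<in> A \<Longrightarrow> A \<in> F" "x \<notin> A \<Longrightarrow> y \<in> A \<Longrightarrow> insert x (A - {y}) \<in> F"
      "A \<in> F \<or> (x \<in> A \<and> y \<notin> A \<and> insert y (A - {x}) \<in> F)"
    using A xy(3) by (auto simp: mem_left_shift_iff split: if_splits)
  consider "x \<in> B \<and> y \<in> B" | "x \<in> B \<and> y \<notin> B" | "x \<notin> B \<and> y \<in> B" | "x \<notin> B \<and> y \<notin> B" by blast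
  then show "B \<in> left_shift x y F"
  proof cases
    case 1
    have "B \<in> F"
      using m(3) up[of A B] up[of "insert y (A - {x})" B] B 1 by blast
    then show ?thesis using 1 xy(3) by (simp add: mem_left_shift_iff)
  next
    case 2
    have "B \<in> F \<or> insert y (B - {x}) \<in> F"
      using m(3) up[of A B] up[of "insert y (A - {x})" "insert y (B - {x})"] B 2 V by blast
    then show ?thesis using 2 xy(3) by (simp add: mem_left_shift_iff)
  next
    case 3
    have "A \<in> F" using m(1) B 3 by blast
    then have "B \<in> F" using up B by blast
    moreover have "insert x (B - {y}) \<in> F"
    proof (cases "y \<in> A")
      case True
      then have "insert x (A - {y}) \<in> F" using m(2) B 3 by blast
      then show ?thesis using up[of "insert x (A - {y})" "insert x (B - {y})"] B V by blast
    next
      case False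
      then show ?thesis using up[OF \<open>A \<in> F\<close>, of "insert x (B - {y})"] B V by blast
    qed
    ultimately show ?thesis using 3 xy(3) by (simp add: mem_left_shift_iff)
  next
    case 4
    have "A \<in> F" using m(1) B 4 by blast
    then have "B \<in> F" using up B by blast
    then show ?thesis using 4 xy(3) by (simp add: mem_left_shift_iff)
  qed
qed

text \<open>Suppose disjoint representatives of the compressed families are given. At most one of them
  contains \<open>x\<close>, so at most one, that of \<open>k\<close> say, fails to lie in the original family, and
  exchanging \<open>x\<close> for \<open>y\<close> repairs it. If another representative contains \<open>y\<close>, then it survived the
  compression although it contains \<open>y\<close> and not \<open>x\<close>, so its family also contains the set with \<open>y\<close>
  exchanged for \<open>x\<close>, and both exchanges together preserve disjointness.\<close>

lemma rainbow_left_shift: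
  assumes "x \<noteq> y" and "rainbow I (\<lambda>i. left_shift x y (F i))"
  shows "rainbow I F"
proof -
  obtain S where S: "\<And>i. i \<in> I \<Longrightarrow> S i \<in> left_shift x y (F i)" "disjoint_family_on S I"
    using assms(2) unfolding rainbow_def by blast
  have dis: "S i \<inter> S j = {}" if "i \<in> I" "j \<in> I" "i \<noteq> j" for i j
    using S(2) that by (auto simp: disjoint_family_on_def)
  show ?thesis
  proof (cases "\<forall>i\<in>I. S i \<in> F i")
    case True
    then show ?thesis using S(2) unfolding rainbow_def by blast
  next
    case False
    then obtain k where k: "k \<in> I" "S k \<notin> F k" by blast
    then have kx: "x \<in> S k" "y \<notin> S k" "insert y (S k - {x}) \<in> F k"
      using S(1)[OF k(1)] assms(1) by (auto simp: mem_left_shift_iff split: if_splits)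
    define T where "T i = (if i = k then insert y (S k - {x})
      else if y \<in> S i then insert x (S i - {y}) else S i)" for i
    have "T i \<in> F i" if "i \<in> I" for i
    proof (cases "i = k")
      case False
      then have "x \<notin> S i" using dis[OF that k(1)] kx by blast
      then show ?thesis using S(1)[OF that] False assms(1)
        by (auto simp: mem_left_shift_iff T_def split: if_splits)
    qed (use kx in \<open>simp add: T_def\<close>)
    moreover have "disjoint_family_on T I"
      unfolding disjoint_family_on_def
    proof (intro ballI impI)
      fix i j assume ij: "i \<in> I" "j \<in> I" "i \<noteq> j"
      have "S i \<inter> S j = {}" "i \<noteq> k \<Longrightarrow> S i \<inter> S k = {}" "j \<noteq> k \<Longrightarrow> S j \<inter> S k = {}"
        using dis ij k(1) by auto
      then show "T i \<inter> T j = {}" using kx(1,2) ij(3) assms(1)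
        unfolding T_def by (auto split: if_splits)
    qed
    ultimately show ?thesis unfolding rainbow_def by blast
  qed
qed

lemma sum_left_shift:
  assumes F: "up_closed V F"
    and w: "\<And>A x y. y \<in> A \<Longrightarrow> x \<notin> A \<Longrightarrow> A \<subseteq> V \<Longrightarrow> x \<in> V \<Longrightarrow> w (insert x (A - {y})) = (w A :: real)"
    and "x \<in> V"
  shows "sum w (left_shift x y F) = sum w F"
  unfolding left_shift_def sum.reindex[OF inj_on_shift_set]
  using w assms(3) up_closed_subset[OF F] by (intro sum.cong) (auto simp: shift_set_def)

text \<open>A compression that changes the family decreases this number, so that compressing has to
  stop.\<close>

definition potential :: "nat set set \<Rightarrow> nat" where
  "potential F = (\<Sum>A\<in>F. \<Sum>A)"

lemma sum_swap_less:
  assumes "finite A" "x < y" "y \<in> A" "x \<notin> A"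
  shows "\<Sum>(insert x (A - {y})) < (\<Sum>A :: nat)"
proof -
  have "\<Sum>A = y + \<Sum>(A - {y})" using assms by (simp add: sum.remove)
  moreover have "\<Sum>(insert x (A - {y})) = x + \<Sum>(A - {y})" using assms by simp
  ultimately show ?thesis using assms by simp
qed

lemma potential_left_shift:
  assumes F: "F \<subseteq> Pow V" "finite V" and "x < y"
  shows "potential (left_shift x y F) \<le> potential F"
    and "A \<in> F \<Longrightarrow> y \<in> A \<Longrightarrow> x \<notin> A \<Longrightarrow> insert x (A - {y}) \<notin> F \<Longrightarrow>
      potential (left_shift x y F) < potential F"
proof -
  have fin: "finite F" using F finite_subset by blast
  have eq: "potential (left_shift x y F) = (\<Sum>A\<in>F. \<Sum>(shift_set x y F A))"
    unfolding potential_def left_shift_def by (simp add: sum.reindex[OF inj_on_shift_set])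
  have finA: "finite A" if "A \<in> F" for A using that F finite_subset by blast
  have le: "\<Sum>(shift_set x y F A) \<le> \<Sum>A" if "A \<in> F" for A
    using sum_swap_less[OF finA[OF that] \<open>x < y\<close>] by (auto simp: shift_set_def)
  show "potential (left_shift x y F) \<le> potential F"
    unfolding eq unfolding potential_def using le by (rule sum_mono)
  show "potential (left_shift x y F) < potential F"
    if A: "A \<in> F" "y \<in> A" "x \<notin> A" "insert x (A - {y}) \<notin> F"
  proof -
    have "\<Sum>(shift_set x y F A) < \<Sum>A"
      using sum_swap_less[OF finA[OF A(1)] \<open>x < y\<close>] A by (auto simp: shift_set_def)
    then show ?thesis unfolding eq unfolding potential_def using le A(1) fin
      by (intro sum_strict_mono_ex1) auto
  qed
qed

text \<open>The weight \<open>w\<close> will be a point probability that depends on the size of a set only. Compressing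
  by one pair at a time keeps the total weight of every family and reflects the existence of
  disjoint representatives, until all families are left-shifted.\<close>

lemma rainbow_by_reduction_to_left_shifted:
  fixes F :: "'i \<Rightarrow> nat set set" and w :: "nat set \<Rightarrow> real"
  assumes V: "finite V" and I: "finite I"
    and w: "\<And>A x y. y \<in> A \<Longrightarrow> x \<notin> A \<Longrightarrow> A \<subseteq> V \<Longrightarrow> x \<in> V \<Longrightarrow> w (insert x (A - {y})) = w A"
    and shifted: "\<And>G. (\<And>i. i \<in> I \<Longrightarrow> up_closed V (G i)) \<Longrightarrow>
      (\<And>i. i \<in> I \<Longrightarrow> left_shifted V (G i)) \<Longrightarrow> (\<And>i. i \<in> I \<Longrightarrow> sum w (G i) > r) \<Longrightarrow> rainbow I G"
    and F: "\<And>i. i \<in> I \<Longrightarrow> up_closed V (F i)" "\<And>i. i \<in> I \<Longrightarrow> sum w (F i) > r"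
  shows "rainbow I F"
  using F
proof (induction "\<Sum>i\<in>I. potential (F i)" arbitrary: F rule: less_induct)
  case less
  show ?case
  proof (cases "\<forall>i\<in>I. left_shifted V (F i)")
    case True
    then show ?thesis using shifted[of F] less.prems by blast
  next
    case False
    then obtain i A x y where *: "i \<in> I" "A \<in> F i" "x \<in> V" "x < y" "y \<in> A" "x \<notin> A"
        "insert x (A - {y}) \<notin> F i"
      unfolding left_shifted_def by blast
    have yV: "y \<in> V" using up_closed_subset[OF less.prems(1)] * by blast
    have sub: "F j \<subseteq> Pow V" if "j \<in> I" for j using less.prems(1)[OF that] by (simp add: up_closed_def)
    have "(\<Sum>i\<in>I. potential (left_shift x y (F i))) < (\<Sum>i\<in>I. potential (F i))"
      using potential_left_shift[OF sub V \<open>x < y\<close>] *(1,2,5-7) I by (intro sum_strict_mono_ex1) blast+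
    moreover have "up_closed V (left_shift x y (F j))" if "j \<in> I" for j
      using up_closed_left_shift[OF less.prems(1)[OF that]] * yV by blast
    moreover have "sum w (left_shift x y (F j)) > r" if "j \<in> I" for j
      using sum_left_shift[OF less.prems(1)[OF that] w] * less.prems(2)[OF that] by simp
    ultimately have "rainbow I (\<lambda>j. left_shift x y (F j))" by (rule less.hyps)
    then show ?thesis using rainbow_left_shift[of x y I F] \<open>x < y\<close> by simp
  qed
qed

section \<open>Elementary probabilities for the thinned bundle\<close>

lemma prob_thinned_bundle_product:
  "measure_pmf.prob (thinned_bundle c m n) {X. \<forall>x\<in>{1..m}. (x \<in> X) \<in> B x} =
    (\<Prod>x\<in>{1..m}. measure_pmf.prob (bernoulli_pmf (c / n)) (B x))"
proof -
  have "(\<lambda>b. {j \<in> {1..m}. b j}) -` {X. \<forall>x\<in>{1..m}. (x \<in> X) \<in> B x} = Pi {1..m} B"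
    by (auto simp: Pi_def)
  then show ?thesis
    unfolding thinned_bundle_def measure_map_pmf by (simp add: measure_Pi_pmf_Pi)
qed

lemma set_pmf_thinned_bundle: "set_pmf (thinned_bundle c m n) \<subseteq> Pow {1..m}"
  by (auto simp: thinned_bundle_def)

lemma prob_bernoulli:
  assumes "0 \<le> p" "p \<le> 1"
  shows "measure_pmf.prob (bernoulli_pmf p) {True} = p"
    and "measure_pmf.prob (bernoulli_pmf p) {False} = 1 - p"
  using assms by (simp_all add: measure_pmf_single)

lemma pmf_thinned_bundle:
  assumes "0 \<le> c" "c \<le> real n" "0 < n" "A \<subseteq> {1..m}"
  shows "pmf (thinned_bundle c m n) A = (c / n) ^ card A * (1 - c / n) ^ (m - card A)"
proof -
  have p: "0 \<le> c / n" "c / n \<le> 1" using assms by auto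
  have "pmf (thinned_bundle c m n) A = measure_pmf.prob (thinned_bundle c m n) {A}"
    by (simp add: measure_pmf_single)
  also have "\<dots> = measure_pmf.prob (thinned_bundle c m n) {X. \<forall>x\<in>{1..m}. (x \<in> X) \<in> {x \<in> A}}"
  proof (rule measure_prob_cong_0)
    fix X assume "X \<in> {X. \<forall>x\<in>{1..m}. (x \<in> X) \<in> {x \<in> A}} - {A}"
    then have "\<not> X \<subseteq> {1..m}" using assms(4) by blast
    then show "pmf (thinned_bundle c m n) X = 0"
      using set_pmf_thinned_bundle[of c m n] by (auto simp: set_pmf_eq)
  qed auto
  also have "\<dots> = (\<Prod>x\<in>{1..m}. if x \<in> A then c / n else 1 - c / n)"
    unfolding prob_thinned_bundle_product
    by (intro prod.cong refl) (auto simp: prob_bernoulli[OF p])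
  also have "\<dots> = (c / n) ^ card ({1..m} \<inter> A) * (1 - c / n) ^ card ({1..m} - A)"
    by (subst prod.If_cases) (auto simp: Diff_eq)
  also have "{1..m} \<inter> A = A" using assms(4) by auto
  also have "card ({1..m} - A) = m - card A" 
    using assms(4) by (simp add: card_Diff_subset finite_subset)
  finally show ?thesis .
qed

lemma prob_superset_le:
  assumes "0 \<le> c" "c \<le> real n" "0 < n" "finite C"
  shows "measure_pmf.prob (thinned_bundle c m n) {X. C \<subseteq> X} \<le> (c / n) ^ card C"
proof (cases "C \<subseteq> {1..m}")
  case True
  have p: "0 \<le> c / n" "c / n \<le> 1" using assms by auto
  have "{X. C \<subseteq> X} = {X. \<forall>x\<in>{1..m}. (x \<in> X) \<in> (if x \<in> C then {True} else UNIV)}"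
    using True by (auto split: if_splits)
  then have "measure_pmf.prob (thinned_bundle c m n) {X. C \<subseteq> X} =
      (\<Prod>x\<in>{1..m}. if x \<in> C then c / n else 1)"
    using prob_thinned_bundle_product[of c m n "\<lambda>x. if x \<in> C then {True} else UNIV"]
      prob_bernoulli[OF p] by (simp add: if_distrib cong: if_cong)
  also have "\<dots> = (c / n) ^ card ({1..m} \<inter> C)"
    by (subst prod.If_cases) auto
  also have "{1..m} \<inter> C = C" using True by auto
  finally show ?thesis by simp
next
  case False
  then have "set_pmf (thinned_bundle c m n) \<inter> {X. C \<subseteq> X} = {}"
    using set_pmf_thinned_bundle[of c m n] by blast
  then have "measure_pmf.prob (thinned_bundle c m n) {X. C \<subseteq> X} = 0"
    by (simp add: measure_pmf_zero_iff)
  then show ?thesis using assms by simp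
qed

lemma prob_avoid_ge:
  assumes "0 \<le> c" "c \<le> real n" "0 < n"
  shows "measure_pmf.prob (thinned_bundle c m n) {X. X \<inter> {1..L} = {}} \<ge> (1 - c / n) ^ L"
proof -
  let ?B = "\<lambda>x. if x \<in> {1..L} then {False} else UNIV"
  have p: "0 \<le> c / n" "c / n \<le> 1" using assms by auto
  have "(1 - c / n) ^ L \<le> (1 - c / n) ^ card ({1..m} \<inter> {1..L})"
    using p card_mono[of "{1..L}" "{1..m} \<inter> {1..L}"] by (intro power_decreasing) auto
  also have "\<dots> = (\<Prod>x\<in>{1..m}. if x \<in> {1..L} then 1 - c / n else 1)"
    by (subst prod.If_cases) (simp_all only: finite_atLeastAtMost prod_constant Collect_mem_eq
      power_one mult_1_right prod.neutral_const)
  also have "\<dots> = (\<Prod>x\<in>{1..m}. measure_pmf.prob (bernoulli_pmf (c / n)) (?B x))"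
    by (intro prod.cong refl) (auto simp: prob_bernoulli[OF p])
  also have "\<dots> = measure_pmf.prob (thinned_bundle c m n) {X. \<forall>x\<in>{1..m}. (x \<in> X) \<in> ?B x}"
    using prob_thinned_bundle_product by simp
  also have "\<dots> = measure_pmf.prob (thinned_bundle c m n) {X. X \<inter> {1..L} = {}}"
  proof (rule measure_prob_cong_0)
    fix X assume "X \<in> {X. \<forall>x\<in>{1..m}. (x \<in> X) \<in> ?B x} - {X. X \<inter> {1..L} = {}}"
    then have "\<not> X \<subseteq> {1..m}" by (auto split: if_splits)
    then show "pmf (thinned_bundle c m n) X = 0"
      using set_pmf_thinned_bundle[of c m n] by (auto simp: set_pmf_eq)
  qed (auto split: if_splits)
  finally show ?thesis .
qed

text \<open>Union bound over the sets of \<open>j\<close> elements of \<open>S\<close>.\<close>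

lemma prob_superset_and_many_le:
  assumes "0 \<le> c" "c \<le> real n" "0 < n" "finite D" "finite S" "D \<inter> S = {}"
  shows "measure_pmf.prob (thinned_bundle c m n) {X. D \<subseteq> X \<and> j \<le> card (X \<inter> S)}
    \<le> (c / n) ^ card D * (real (card S choose j) * (c / n) ^ j)"
proof -
  let ?M = "thinned_bundle c m n"
  let ?\<C> = "{C. C \<subseteq> S \<and> card C = j}"
  have fin: "finite ?\<C>" using assms(5) by simp
  have "{X. D \<subseteq> X \<and> j \<le> card (X \<inter> S)} \<subseteq> (\<Union>C\<in>?\<C>. {X. D \<union> C \<subseteq> X})"
  proof
    fix X assume X: "X \<in> {X. D \<subseteq> X \<and> j \<le> card (X \<inter> S)}"
    then have "j \<le> card (X \<inter> S)" by blast
    then obtain C where "C \<subseteq> X \<inter> S" "card C = j"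
      by (rule obtain_subset_with_card_n)
    then show "X \<in> (\<Union>C\<in>?\<C>. {X. D \<union> C \<subseteq> X})" using X by blast
  qed
  then have "measure_pmf.prob ?M {X. D \<subseteq> X \<and> j \<le> card (X \<inter> S)} \<le>
      measure_pmf.prob ?M (\<Union>C\<in>?\<C>. {X. D \<union> C \<subseteq> X})"
    by (intro measure_pmf.finite_measure_mono) auto
  also have "\<dots> \<le> (\<Sum>C\<in>?\<C>. measure_pmf.prob ?M {X. D \<union> C \<subseteq> X})"
    using fin by (intro measure_pmf.finite_measure_subadditive_finite) auto
  also have "\<dots> \<le> (\<Sum>C\<in>?\<C>. (c / n) ^ (card D + j))"
  proof (rule sum_mono)
    fix C assume C: "C \<in> ?\<C>"
    then have "finite C" using assms(5) finite_subset by blast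
    moreover have "card (D \<union> C) = card D + j"
      using C assms(4,6) \<open>finite C\<close> by (subst card_Un_disjoint) auto
    ultimately show "measure_pmf.prob ?M {X. D \<union> C \<subseteq> X} \<le> (c / n) ^ (card D + j)"
      using prob_superset_le[OF assms(1-3), of "D \<union> C" m] assms(4) by simp
  qed
  also have "\<dots> = (c / n) ^ card D * (real (card S choose j) * (c / n) ^ j)"
    using assms(5) by (simp add: n_subsets power_add)
  finally show ?thesis .
qed

text \<open>The estimate \<open>(N choose j) \<le> N ^ j / j!\<close> combined with \<open>j ^ j / j! \<le> exp j \<le> 3 ^ j\<close>, where
  \<open>j ^ j / j!\<close> is at most \<open>exp j\<close> as a term of the exponential series. It gives geometric decay
  in \<open>j\<close> when \<open>N\<close> grows linearly in \<open>j\<close>.\<close>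

lemma binomial_mult_power_le:
  fixes q r :: real
  assumes "0 \<le> q" "0 < j" "real N * q \<le> r * j"
  shows "real (N choose j) * q ^ j \<le> (3 * r) ^ j"
proof -
  have "(real j) ^ j / fact j \<le> exp (real j)"
  proof -
    have "(\<Sum>n\<in>{j}. (real j) ^ n /\<^sub>R fact n) \<le> (\<Sum>n. (real j) ^ n /\<^sub>R fact n)"
      by (intro sum_le_suminf summable_exp_generic) auto
    then show ?thesis by (simp add: exp_def field_simps)
  qed
  also have "\<dots> = exp 1 ^ j" by (simp add: exp_of_nat_mult[symmetric])
  also have "\<dots> \<le> 3 ^ j" using exp_le by (intro power_mono) auto
  finally have fact: "(real j) ^ j \<le> 3 ^ j * fact j" by (simp add: field_simps)
  have "real (N choose j) * fact j \<le> real N ^ j"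
    using binomial_fact_pow[of N j] by (metis of_nat_fact of_nat_le_iff of_nat_mult of_nat_power)
  then have "real (N choose j) * q ^ j * fact j \<le> real N ^ j * q ^ j"
    using mult_right_mono[of "real (N choose j) * fact j" "real N ^ j" "q ^ j"] assms(1)
    by (simp add: mult_ac)
  also have "\<dots> = (real N * q) ^ j" by (simp add: power_mult_distrib)
  also have "\<dots> \<le> (r * j) ^ j" using assms by (intro power_mono) auto
  also have "\<dots> = r ^ j * real j ^ j" by (simp add: power_mult_distrib)
  also have "\<dots> \<le> r ^ j * (3 ^ j * fact j)"
  proof -
    have "0 \<le> real N * q" using assms(1) by simp
    then have "0 \<le> r * j" using assms(3) by linarith
    then have "0 \<le> r" using assms(2) by (simp add: zero_le_mult_iff)
    then show ?thesis using fact by (intro mult_left_mono) auto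
  qed
  also have "\<dots> = (3 * r) ^ j * fact j" by (simp add: power_mult_distrib)
  finally show ?thesis by simp
qed

lemma prob_UN_geometric_le:
  fixes M :: "'a pmf" and a C r :: real
  assumes le: "\<And>j. k \<le> j \<Longrightarrow> measure_pmf.prob M (E j) \<le> C * r ^ j" and r: "0 \<le> r" "r \<le> 1 / 2" and "0 \<le> C"
  shows "measure_pmf.prob M (\<Union>j\<in>{k..}. E j) \<le> 2 * C * r ^ k"
proof -
  have sums: "(\<lambda>i. (C * r ^ k) * r ^ i) sums ((C * r ^ k) * (1 / (1 - r)))"
    using r by (intro sums_mult geometric_sums) auto
  have le': "measure_pmf.prob M (E (k + i)) \<le> (C * r ^ k) * r ^ i" for i
    using le[of "k + i"] by (simp add: power_add mult.assoc)
  have summ: "summable (\<lambda>i. measure_pmf.prob M (E (k + i)))"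
    using le' by (intro summable_comparison_test'[OF sums_summable[OF sums]]) simp
  have "(\<Union>j\<in>{k..}. E j) = (\<Union>i. E (k + i))"
    using le_Suc_ex by fastforce
  then have "measure_pmf.prob M (\<Union>j\<in>{k..}. E j) \<le> (\<Sum>i. measure_pmf.prob M (E (k + i)))"
    using summ by (simp, intro measure_pmf.finite_measure_subadditive_countably) auto
  also have "\<dots> \<le> (C * r ^ k) * (1 / (1 - r))"
    using suminf_le[OF le' summ sums_summable[OF sums]] sums_unique[OF sums] by simp
  also have "\<dots> \<le> (C * r ^ k) * 2"
    using r assms(4) by (intro mult_left_mono) (auto simp: field_simps)
  finally show ?thesis by simp
qed

section \<open>Crowded bundles are rare\<close>

text \<open>With \<open>k = n - L\<close>, this is a necessary condition for a set \<open>X\<close> of goods above \<open>L\<close> to be too dense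
  for both kinds of bundles constructed below. If \<open>X\<close> is too dense for progressions of difference
  \<open>2 * k\<close> that start above \<open>L\<close>, then it satisfies the first disjunct or has an element \<open>x\<close> as in the
  second one; if it is also too dense for one good together with a progression of difference
  \<open>2 * n\<close>, then \<open>x\<close> is accompanied by other early elements. Either way \<open>X\<close> contains
  two goods that are atypically early, one of them on the scale of \<open>k\<close>.\<close>

definition crowded :: "nat \<Rightarrow> nat \<Rightarrow> nat \<Rightarrow> nat set \<Rightarrow> bool" where
  "crowded n L k X \<longleftrightarrow>
     (\<exists>j\<ge>2. j \<le> card (X \<inter> {L<..L + 2 * k * j})) \<or>
     (\<exists>x\<in>{L<..L + 2 * k}. \<exists>i\<ge>1. x \<in> X \<and> i \<le> card (X \<inter> ({1..2 * n * (i + 1)} - {x})))"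

text \<open>With \<open>p = c / n\<close>, both disjuncts have probability at most of order \<open>k * p\<close>, for an early good on
  the scale of \<open>k\<close>, times \<open>c\<close>, for a second early good. The factor \<open>c\<close> is what makes this
  smaller than the gap of order \<open>k * p\<close> that the quantile \<open>exp (- c)\<close> leaves.\<close>

lemma prob_crowded_le:
  assumes c: "0 \<le> c" "c \<le> 1 / 480" and "0 < n" "k \<le> n"
  shows "measure_pmf.prob (thinned_bundle c m n) {X. crowded n L k X} \<le> real k * (c / n) / 4"
proof -
  let ?M = "thinned_bundle c m n"
  let ?P = "measure_pmf.prob ?M"
  define p where "p = c / n"
  have p: "0 \<le> p" "n * p = c" using assms by (auto simp: p_def)
  have kp: "0 \<le> k * p" "k * p \<le> c" 
    using p assms(4) mult_right_mono[of "real k" "real n" p] by auto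
  have cn: "c \<le> real n" using assms(2,3) by linarith
  define E where "E j = {X. j \<le> card (X \<inter> {L<..L + 2 * k * j})}" for j
  define G where "G x i = {X. x \<in> X \<and> i \<le> card (X \<inter> ({1..2 * n * (i + 1)} - {x}))}" for x i
  have "?P (E j) \<le> 1 * (6 * (k * p)) ^ j" if "2 \<le> j" for j
  proof -
    have "?P (E j) \<le> real (2 * k * j choose j) * p ^ j"
      using prob_superset_and_many_le[OF c(1) cn assms(3), of "{}" "{L<..L + 2 * k * j}" m j]
      by (simp add: E_def p_def)
    also have "\<dots> \<le> (3 * (2 * (k * p))) ^ j"
      using that p by (intro binomial_mult_power_le) auto
    finally show ?thesis by simp
  qed
  then have "?P (\<Union>j\<in>{2..}. E j) \<le> 2 * 1 * (6 * (k * p)) ^ 2"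
    using kp c(2) by (intro prob_UN_geometric_le) auto
  also have "\<dots> = 72 * ((k * p) * (k * p))" by (simp add: power2_eq_square)
  also have "\<dots> \<le> 72 * ((k * p) * c)" using kp by (intro mult_left_mono) auto
  finally have E: "?P (\<Union>j\<in>{2..}. E j) \<le> 72 * ((k * p) * c)" .
  have G: "?P (\<Union>i\<in>{1..}. G x i) \<le> 24 * c * p" for x
  proof -
    have "?P (G x i) \<le> p * (12 * c) ^ i" if "1 \<le> i" for i
    proof -
      let ?S = "{1..2 * n * (i + 1)} - {x}"
      have "?P (G x i) \<le> p * (real (card ?S choose i) * p ^ i)"
        using prob_superset_and_many_le[OF c(1) cn assms(3), of "{x}" ?S m i]
        by (simp add: G_def p_def)
      also have "real (card ?S choose i) * p ^ i \<le> (3 * (4 * c)) ^ i"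
      proof (rule binomial_mult_power_le)
        have "card ?S \<le> 2 * n * (i + 1)" using card_mono[of "{1..2 * n * (i + 1)}" ?S] by auto
        also have "\<dots> \<le> 4 * n * i" using that mult_le_mono2[of "i + 1" "2 * i" "2 * n"] by simp
        finally have "real (card ?S) \<le> real (4 * n * i)" by (rule of_nat_mono)
        then have "real (card ?S) * p \<le> real (4 * n * i) * p" using p(1) by (rule mult_right_mono)
        also have "\<dots> = 4 * (n * p) * i" by simp
        finally show "real (card ?S) * p \<le> 4 * c * i" using p(2) by simp
      qed (use p that in auto)
      finally show ?thesis using p by (simp add: mult_left_mono)
    qed
    then have "?P (\<Union>i\<in>{1..}. G x i) \<le> 2 * p * (12 * c) ^ 1"
      using p c by (intro prob_UN_geometric_le) auto
    then show ?thesis by (simp add: mult_ac)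
  qed
  have "{X. crowded n L k X} \<subseteq> (\<Union>j\<in>{2..}. E j) \<union> (\<Union>x\<in>{L<..L + 2 * k}. \<Union>i\<in>{1..}. G x i)"
    unfolding crowded_def E_def G_def by blast
  then have "?P {X. crowded n L k X} \<le> ?P ((\<Union>j\<in>{2..}. E j) \<union> (\<Union>x\<in>{L<..L + 2 * k}. \<Union>i\<in>{1..}. G x i))"
    by (intro measure_pmf.finite_measure_mono) auto
  also have "\<dots> \<le> ?P (\<Union>j\<in>{2..}. E j) + ?P (\<Union>x\<in>{L<..L + 2 * k}. \<Union>i\<in>{1..}. G x i)"
    by (intro measure_Un_le) auto
  also have "?P (\<Union>x\<in>{L<..L + 2 * k}. \<Union>i\<in>{1..}. G x i) \<le>
      (\<Sum>x\<in>{L<..L + 2 * k}. ?P (\<Union>i\<in>{1..}. G x i))"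
    by (intro measure_pmf.finite_measure_subadditive_finite) auto
  also have "\<dots> \<le> (\<Sum>x\<in>{L<..L + 2 * k}. 24 * c * p)" by (intro sum_mono G)
  also have "\<dots> = 48 * ((k * p) * c)" by simp
  finally have "?P {X. crowded n L k X} \<le> 120 * ((k * p) * c)" using E by simp
  also have "\<dots> \<le> 120 * ((k * p) * (1 / 480))" using kp c by (intro mult_left_mono) auto
  finally show ?thesis by (simp add: p_def mult_ac)
qed

text \<open>The power is \<open>exp (- c + k * p)\<close> up to terms of second order, where \<open>p = c / n\<close>. The bound on \<open>c\<close>
  makes these negligible.\<close>

lemma exp_plus_gap_le_power:
  fixes c :: real
  assumes c: "0 \<le> c" "c \<le> 1 / 480" and k: "1 \<le> k" "k \<le> n"
  shows "exp (- c) + real k * (c / n) / 4 \<le> (1 - c / n) ^ (n - k)"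
proof -
  define p where "p = c / n"
  have n: "0 < real n" using k by simp
  have p: "0 \<le> p" "real n * p = c" "p \<le> 1 / 2"
    using c k n by (auto simp: p_def field_simps) 
  have kp: "0 \<le> real k * p" using p by simp
  have "real (n - k) * (- p - 2 * p\<^sup>2) = - c + real k * p - 2 * (real (n - k) * p) * p"
    using p(2) k by (simp add: of_nat_diff algebra_simps power2_eq_square)
  moreover have "(real (n - k) * p) * p \<le> real k * p * c"
  proof -
    have "real (n - k) * p \<le> c" using p k by (simp add: of_nat_diff algebra_simps)
    then have "(real (n - k) * p) * p \<le> c * p" using p(1) by (rule mult_right_mono)
    also have "\<dots> \<le> real k * p * c" using k c p(1) mult_right_mono[of 1 "real k" "p * c"]
      by (simp add: mult_ac)
    finally show ?thesis .
  qed
  moreover have "real k * p * c \<le> real k * p * (1 / 480)" using kp c by (intro mult_left_mono)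
  ultimately have e: "- c + real k * p / 2 \<le> real (n - k) * (- p - 2 * p\<^sup>2)" using kp by linarith
  have "1 / 2 \<le> exp (- c)" using exp_ge_add_one_self[of "- c"] c by linarith
  then have "1 / 2 * (real k * p / 2) \<le> exp (- c) * (real k * p / 2)"
    using kp by (intro mult_right_mono) auto
  then have "exp (- c) + real k * p / 4 \<le> exp (- c) * (1 + real k * p / 2)"
    by (simp add: algebra_simps)
  also have "\<dots> \<le> exp (- c) * exp (real k * p / 2)"
    by (intro mult_left_mono) auto
  also have "\<dots> = exp (- c + real k * p / 2)" by (simp only: exp_add)
  also have "\<dots> \<le> exp (real (n - k) * (- p - 2 * p\<^sup>2))" using e by simp
  also have "\<dots> = exp (- p - 2 * p\<^sup>2) ^ (n - k)" by (rule exp_of_nat_mult)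
  also have "\<dots> \<le> (1 - p) ^ (n - k)"
  proof (rule power_mono)
    have "exp (- p - 2 * p\<^sup>2) \<le> exp (ln (1 - p))"
      using ln_one_minus_pos_lower_bound[OF p(1,3)] by simp
    then show "exp (- p - 2 * p\<^sup>2) \<le> 1 - p" using p by simp
  qed simp
  finally show ?thesis by (simp add: p_def)
qed

section \<open>Disjoint bundles that dominate sparse sets\<close>

definition progression :: "nat \<Rightarrow> nat \<Rightarrow> nat \<Rightarrow> nat set" where
  "progression L M r = {y. L < y \<and> (y - Suc L) mod M = r}"

lemma card_progression_ge:
  assumes "r < M"
  shows "(t - L) div M \<le> card (progression L M r \<inter> {..t})"
proof -
  let ?f = "\<lambda>q. Suc L + r + M * q"
  have "?f ` {..<(t - L) div M} \<subseteq> progression L M r \<inter> {..t}"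
  proof
    fix y assume "y \<in> ?f ` {..<(t - L) div M}"
    then obtain q where q: "q < (t - L) div M" "y = ?f q" by auto
    have "M * Suc q \<le> M * ((t - L) div M)" using q by (intro mult_le_mono2) auto
    also have "\<dots> \<le> t - L" by (metis mult.commute div_times_less_eq_dividend)
    finally have "M * Suc q \<le> t - L" .
    then have "y \<le> t" using q(2) assms by simp
    then show "y \<in> progression L M r \<inter> {..t}" using q(2) assms by (simp add: progression_def)
  qed
  then have "card (?f ` {..<(t - L) div M}) \<le> card (progression L M r \<inter> {..t})"
    by (intro card_mono) auto
  moreover have "inj_on ?f {..<(t - L) div M}" using assms by (intro inj_onI) auto
  ultimately show ?thesis by (simp add: card_image)
qed

lemma progression_same_modulus_disjoint:
  "r \<noteq> r' \<Longrightarrow> progression L M r \<inter> progression L M r' = {}"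
  by (auto simp: progression_def)

text \<open>The bundles with one of the goods \<open>1, \<dots>, L\<close> will use odd residues and the others even ones, so that
  their progressions do not meet although their differences are unrelated.\<close>

lemma progression_parity_disjoint:
  "progression L (2 * M) (2 * u) \<inter> progression L (2 * N) (2 * v + 1) = {}"
proof -
  have "(2 * u) mod 2 \<noteq> (2 * v + 1) mod (2::nat)" by simp
  moreover have "z mod (2 * M) = 2 * u \<Longrightarrow> z mod 2 = (2 * u) mod 2" for z
    by (metis dvd_triv_left mod_mod_cancel)
  moreover have "z mod (2 * N) = 2 * v + 1 \<Longrightarrow> z mod 2 = (2 * v + 1) mod 2" for z
    by (metis dvd_triv_left mod_mod_cancel)
  ultimately show ?thesis unfolding progression_def by fastforce
qed

text \<open>The two violated bounds are lower bounds for the sizes of the two kinds of bundles on initial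
  segments: one good and a progression of difference \<open>2 * n\<close>, and a progression of difference
  \<open>2 * (n - L)\<close> above \<open>L\<close>.\<close>

lemma crowdedI:
  assumes A: "finite A" "0 \<notin> A" "A \<inter> {1..L} = {}" and "L < n"
    and t1: "\<not> card (A \<inter> {..t1}) \<le> 1 + (t1 - n) div (2 * n)"
    and t2: "\<not> card (A \<inter> {..t2}) \<le> (t2 - L) div (2 * (n - L))"
  shows "crowded n L (n - L) A"
proof -
  define j where "j = card (A \<inter> {..t2})"
  have "(t2 - L) div (2 * (n - L)) < j" using t2 by (simp add: j_def)
  then have "t2 - L < j * (2 * (n - L))" using \<open>L < n\<close> by (simp add: div_less_iff_less_mult)
  then have "t2 < L + 2 * (n - L) * j" by (simp add: mult.commute)
  moreover have "L < x" if "x \<in> A" for x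
  proof (rule ccontr)
    assume "\<not> L < x"
    moreover have "x \<noteq> 0" using A(2) that by metis
    ultimately show False using A(3) that by auto
  qed
  ultimately have "A \<inter> {..t2} \<subseteq> A \<inter> {L<..L + 2 * (n - L) * j}" by fastforce
  then have j: "j \<le> card (A \<inter> {L<..L + 2 * (n - L) * j})"
    unfolding j_def using A(1) by (intro card_mono) auto
  show ?thesis
  proof (cases "2 \<le> j")
    case True
    then show ?thesis using j unfolding crowded_def by blast
  next
    case False
    with t2 have "j = 1" by (simp add: j_def)
    then have "A \<inter> {L<..L + 2 * (n - L)} \<noteq> {}" using j by auto
    then obtain x where x: "x \<in> A" "x \<in> {L<..L + 2 * (n - L)}" by blast
    define i where "i = card (A \<inter> {..t1}) - 1"
    have i: "card (A \<inter> {..t1}) = i + 1" "(t1 - n) div (2 * n) < i" using t1 by (auto simp: i_def)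
    then have "t1 - n < i * (2 * n)" using \<open>L < n\<close> by (simp add: div_less_iff_less_mult)
    then have "t1 \<le> 2 * n * (i + 1)" by (simp add: mult.commute)
    then have "A \<inter> {..t1} \<subseteq> A \<inter> {1..2 * n * (i + 1)}"
      using A(2) by (auto simp: Suc_le_eq intro: gr0I)
    then have "i + 1 \<le> card (A \<inter> {1..2 * n * (i + 1)})"
      unfolding i(1)[symmetric] using A(1) by (intro card_mono) auto
    also have "\<dots> \<le> card (insert x (A \<inter> ({1..2 * n * (i + 1)} - {x})))"
      using A(1) by (intro card_mono) auto
    also have "\<dots> = card (A \<inter> ({1..2 * n * (i + 1)} - {x})) + 1" using A(1) by simp
    finally have "i \<le> card (A \<inter> ({1..2 * n * (i + 1)} - {x}))" by simp
    moreover have "1 \<le> i" using i(2) by simp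
    ultimately show ?thesis using x unfolding crowded_def by blast
  qed
qed

text \<open>Each bundle only has to dominate one set of the agent's family. As many agents as possible,
  \<open>L\<close> of them, are served by one of the goods \<open>1, \<dots>, L\<close> and a progression of difference \<open>2 * n\<close>.
  The other \<open>n - L\<close> agents get progressions of the smaller difference \<open>2 * (n - L)\<close>. The choice of
  \<open>L\<close> is what makes this work: such an agent could not have been served with the good \<open>L + 1\<close>, so
  the uncrowded member of its family that avoids \<open>1, \<dots>, L\<close> must be sparse enough for the
  progression.\<close>

lemma rainbow_if_uncrowded:
  fixes F :: "'i \<Rightarrow> nat set set"
  assumes I: "finite I" "card I = n"
    and F: "\<And>i. i \<in> I \<Longrightarrow> up_closed {1..m} (F i)" "\<And>i. i \<in> I \<Longrightarrow> left_shifted {1..m} (F i)"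
    and uncrowded: "\<And>i L. i \<in> I \<Longrightarrow> L < n \<Longrightarrow>
      \<exists>A\<in>F i. A \<inter> {1..L} = {} \<and> \<not> crowded n L (n - L) A"
  shows "rainbow I F"
proof -
  (* The bound uses t - n although the progression starts above L, so that it does not depend
     on L, which is chosen only afterwards. *)
  define accepts where "accepts i s \<longleftrightarrow> (\<exists>A\<in>F i. A \<inter> {..<s} = {} \<and>
      (\<forall>t. card (A \<inter> {..t}) \<le> 1 + (t - n) div (2 * n)))" for i s
  define served where "served L g \<longleftrightarrow> L \<le> n \<and> inj_on g {1..L} \<and> g ` {1..L} \<subseteq> I \<and>
      (\<forall>s\<in>{1..L}. accepts (g s) s)" for L g
  define L where "L = (GREATEST L. \<exists>g. served L g)"
  have "\<exists>g. served L g" unfolding L_def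
  proof (rule GreatestI_nat)
    show "\<exists>g. served 0 g" by (simp add: served_def)
  qed (auto simp: served_def)
  then obtain g where g: "served L g" by blast
  have L_max: "L' \<le> L" if "served L' g'" for L' g'
    unfolding L_def using that by (intro Greatest_le_nat[where b = n]) (auto simp: served_def)
  have Ln: "L \<le> n" and inj: "inj_on g {1..L}" and gI: "g ` {1..L} \<subseteq> I"
    and acc: "\<And>s. s \<in> {1..L} \<Longrightarrow> accepts (g s) s"
    using g by (auto simp: served_def)
  define U where "U = I - g ` {1..L}"
  define k where "k = n - L"
  have "card U = k" "finite U"
    using gI I card_image[OF inj] by (auto simp: U_def k_def card_Diff_subset)
  then obtain h where h: "bij_betw h U {0..<k}" using ex_bij_betw_finite_nat by blast
  define s where "s i = inv_into {1..L} g i" for i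
  have s: "s i \<in> {1..L}" "g (s i) = i" if "i \<in> I - U" for i
    using that unfolding s_def U_def by (auto intro: inv_into_into f_inv_into_f simp del: atLeastAtMost_iff)
  define B where "B i = (if i \<in> U then progression L (2 * k) (2 * h i)
      else insert (s i) (progression L (2 * n) (2 * (s i - 1) + 1)))" for i
  have "{1..m} \<inter> B i \<in> F i" if i: "i \<in> I" for i
  proof (cases "i \<in> U")
    case True
    then have hi: "h i < k" using h by (auto simp: bij_betw_def)
    then have "L < n" by (simp add: k_def)
    then obtain A where A: "A \<in> F i" "A \<inter> {1..L} = {}" "\<not> crowded n L k A"
      using uncrowded[OF i] unfolding k_def by blast
    have Am: "A \<subseteq> {1..m}" using up_closed_subset[OF F(1)[OF i] A(1)] .
    then have A0: "finite A" "0 \<notin> A" by (auto intro: finite_subset)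
    have "\<not> accepts i (L + 1)"
    proof
      assume a: "accepts i (L + 1)"
      let ?g = "g(L + 1 := i)"
      have old: "?g s' = g s'" if "s' \<in> {1..L}" for s' using that by simp
      have new: "s' = L + 1" if "s' \<in> {1..L + 1}" "s' \<notin> {1..L}" for s' using that by auto
      have "i \<notin> g ` {1..L}" using True by (simp add: U_def)
      then have "inj_on ?g {1..L + 1}"
        using inj old new unfolding inj_on_def by (metis fun_upd_same image_eqI)
      moreover have "?g ` {1..L + 1} \<subseteq> I"
        using gI i old new by (metis fun_upd_same image_subset_iff)
      moreover have "\<forall>s\<in>{1..L + 1}. accepts (?g s) s"
        using acc a old new by (metis fun_upd_same)
      ultimately have "served (L + 1) ?g" using \<open>L < n\<close> by (simp add: served_def)
      then show False using L_max by fastforce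
    qed
    moreover have "A \<inter> {..<L + 1} = {}"
    proof -
      have "{..<L + 1} \<subseteq> insert 0 {1..L}" by auto
      then show ?thesis using A(2) A0(2) by blast
    qed
    ultimately have "\<exists>t. \<not> card (A \<inter> {..t}) \<le> 1 + (t - n) div (2 * n)"
      using A(1) unfolding accepts_def by blast
    then have sparse: "card (A \<inter> {..t}) \<le> (t - L) div (2 * k)" for t
      using crowdedI[OF A0 A(2) \<open>L < n\<close>] A(3) unfolding k_def by blast
    have "{1..m} \<inter> progression L (2 * k) (2 * h i) \<in> F i"
    proof (rule shifted_dominated_truncated[OF F(1)[OF i] F(2)[OF i] A(1)])
      show "card (A \<inter> {..t}) \<le> card (progression L (2 * k) (2 * h i) \<inter> {..t})" for t
        using sparse[of t] card_progression_ge[of "2 * h i" "2 * k" t L] hi by simp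
    qed (simp add: progression_def)
    then show ?thesis using True by (simp add: B_def)
  next
    case False
    then have si: "s i \<in> {1..L}" "g (s i) = i" using s i by auto
    then obtain A where A: "A \<in> F i" "A \<inter> {..<s i} = {}"
        "\<And>t. card (A \<inter> {..t}) \<le> 1 + (t - n) div (2 * n)"
      using acc[OF si(1)] unfolding accepts_def by auto
    let ?P = "progression L (2 * n) (2 * (s i - 1) + 1)"
    have "{1..m} \<inter> insert (s i) ?P \<in> F i"
    proof (rule shifted_dominated_truncated[OF F(1)[OF i] F(2)[OF i] A(1)])
      show "card (A \<inter> {..t}) \<le> card (insert (s i) ?P \<inter> {..t})" for t
      proof (cases "t < s i")
        case True
        then have "A \<inter> {..t} = {}" using A(2) by auto
        then show ?thesis by simp
      next
        case False
        have "s i \<notin> ?P" using si by (simp add: progression_def)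
        then have "card (insert (s i) ?P \<inter> {..t}) = 1 + card (?P \<inter> {..t})" using False by simp
        moreover have "(t - n) div (2 * n) \<le> (t - L) div (2 * n)" using Ln by (intro div_le_mono) auto
        moreover have "(t - L) div (2 * n) \<le> card (?P \<inter> {..t})"
          using si Ln by (intro card_progression_ge) auto
        ultimately show ?thesis using A(3)[of t] by linarith
      qed
    qed (use si in \<open>auto simp: progression_def\<close>)
    then show ?thesis using False by (simp add: B_def)
  qed
  moreover have "disjoint_family_on (\<lambda>i. {1..m} \<inter> B i) I"
    unfolding disjoint_family_on_def
  proof (intro ballI impI)
    fix i j assume ij: "i \<in> I" "j \<in> I" "i \<noteq> j"
    have above: "y \<notin> progression L M r" if "y \<le> L" for y M r
      using that by (simp add: progression_def)
    have mixed: "B a \<inter> B b = {}" if "a \<in> U" "b \<in> I - U" for a b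
      using that s(1)[OF that(2)] above[of "s b"]
        progression_parity_disjoint[of L k "h a" n "s b - 1"]
      unfolding B_def by auto
    have "B i \<inter> B j = {}"
    proof (cases "i \<in> U"; cases "j \<in> U")
      assume *: "i \<in> U" "j \<in> U"
      then have "2 * h i \<noteq> 2 * h j" using h ij(3) by (auto simp: bij_betw_def inj_on_def)
      then show ?thesis using * progression_same_modulus_disjoint unfolding B_def by simp
    next
      assume *: "i \<notin> U" "j \<notin> U"
      then have si: "s i \<in> {1..L}" "g (s i) = i" and sj: "s j \<in> {1..L}" "g (s j) = j"
        using s ij by auto
      then have "s i \<noteq> s j" using ij(3) by auto
      moreover from this have "2 * (s i - 1) + 1 \<noteq> 2 * (s j - 1) + 1" using si(1) sj(1) by auto
      then have "progression L (2 * n) (2 * (s i - 1) + 1) \<inter>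
          progression L (2 * n) (2 * (s j - 1) + 1) = {}" by (rule progression_same_modulus_disjoint)
      ultimately show ?thesis using * si(1) sj(1) above unfolding B_def by auto
    qed (use mixed ij in blast)+
    then show "({1..m} \<inter> B i) \<inter> ({1..m} \<inter> B j) = {}" by blast
  qed
  ultimately show ?thesis
    unfolding rainbow_def by (intro exI[of _ "\<lambda>i. {1..m} \<inter> B i"]) simp
qed

section \<open>Disjoint representatives of likely families\<close>

text \<open>Otherwise every member of \<open>F\<close> meets \<open>{1..L}\<close> or is crowded. The first has probability at most
  \<open>1 - (1 - c / n) ^ L\<close>, and as \<open>L \<le> n - 1\<close> this falls short of \<open>1 - exp (- c)\<close> by at least
  as much as crowded sets can contribute.\<close>

lemma uncrowded_member_exists:
  assumes c: "0 \<le> c" "c \<le> 1 / 480" and "L < n"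
    and F: "measure_pmf.prob (thinned_bundle c m n) F > 1 - exp (- c)"
  shows "\<exists>A\<in>F. A \<inter> {1..L} = {} \<and> \<not> crowded n L (n - L) A"
proof (rule ccontr)
  let ?P = "measure_pmf.prob (thinned_bundle c m n)"
  have n: "0 < n" using \<open>L < n\<close> by simp
  then have cn: "c \<le> real n" using c(2) by linarith
  assume "\<not> ?thesis"
  then have "F \<subseteq> - {X. X \<inter> {1..L} = {}} \<union> {X. crowded n L (n - L) X}" by blast
  then have "?P F \<le> ?P (- {X. X \<inter> {1..L} = {}} \<union> {X. crowded n L (n - L) X})"
    by (intro measure_pmf.finite_measure_mono) auto
  also have "\<dots> \<le> ?P (- {X. X \<inter> {1..L} = {}}) + ?P {X. crowded n L (n - L) X}"
    by (intro measure_Un_le) auto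
  also have "?P (- {X. X \<inter> {1..L} = {}}) = 1 - ?P {X. X \<inter> {1..L} = {}}"
    by (simp add: measure_pmf.prob_compl[symmetric] Compl_eq_Diff_UNIV)
  finally have "?P F \<le> 1 - ?P {X. X \<inter> {1..L} = {}} + ?P {X. crowded n L (n - L) X}" .
  moreover have "(1 - c / n) ^ L \<le> ?P {X. X \<inter> {1..L} = {}}"
    using prob_avoid_ge[OF c(1) cn n] .
  moreover have "?P {X. crowded n L (n - L) X} \<le> real (n - L) * (c / n) / 4"
    using prob_crowded_le[OF c n] by simp
  moreover have "exp (- c) + real (n - L) * (c / n) / 4 \<le> (1 - c / n) ^ L"
    using exp_plus_gap_le_power[OF c, of "n - L" n] \<open>L < n\<close> by simp
  ultimately show False using F by linarith
qed

theorem rainbow_if_prob_gt: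
  fixes F :: "'i \<Rightarrow> nat set set"
  assumes c: "0 \<le> c" "c \<le> 1 / 480" and I: "finite I" "card I = n"
    and F: "\<And>i. i \<in> I \<Longrightarrow> up_closed {1..m} (F i)"
      "\<And>i. i \<in> I \<Longrightarrow> measure_pmf.prob (thinned_bundle c m n) (F i) > 1 - exp (- c)"
  shows "rainbow I F"
proof (cases "n = 0")
  case True
  then show ?thesis using I by (simp add: rainbow_def disjoint_family_on_def)
next
  case False
  then have n: "0 < n" by simp
  then have cn: "c \<le> real n" using c(2) by linarith
  let ?w = "pmf (thinned_bundle c m n)"
  have prob: "measure_pmf.prob (thinned_bundle c m n) G = sum ?w G" if "up_closed {1..m} G" for G
    using that by (intro measure_measure_pmf_finite) (auto simp: up_closed_def intro: finite_subset)
  show ?thesis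
  proof (rule rainbow_by_reduction_to_left_shifted[of "{1..m}" I ?w "1 - exp (- c)"])
    fix A :: "nat set" and x y assume *: "y \<in> A" "x \<notin> A" "A \<subseteq> {1..m}" "x \<in> {1..m}"
    then have "finite A" using finite_subset by blast
    then have "card (insert x (A - {y})) = card A" using * card_Suc_Diff1[of A y] by simp
    moreover have "insert x (A - {y}) \<subseteq> {1..m}" using * by blast
    ultimately show "?w (insert x (A - {y})) = ?w A"
      using pmf_thinned_bundle[OF c(1) cn n] *(3) by simp
  next
    fix G :: "'i \<Rightarrow> nat set set"
    assume G: "\<And>i. i \<in> I \<Longrightarrow> up_closed {1..m} (G i)" "\<And>i. i \<in> I \<Longrightarrow> left_shifted {1..m} (G i)"
      "\<And>i. i \<in> I \<Longrightarrow> sum ?w (G i) > 1 - exp (- c)"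
    have "1 - exp (- c) < measure_pmf.prob (thinned_bundle c m n) (G i)" if "i \<in> I" for i
      using prob[OF G(1)[OF that]] G(3)[OF that] by simp
    then have "\<exists>A\<in>G i. A \<inter> {1..L} = {} \<and> \<not> crowded n L (n - L) A" if "i \<in> I" "L < n" for i L
      using uncrowded_member_exists[OF c that(2)] that(1) by blast
    then show "rainbow I G" using rainbow_if_uncrowded[OF I, where F = G] G(1,2) by blast
  qed (use I F prob[OF F(1)] in auto)
qed

section \<open>Quantile shares\<close>

lemma monotone_valuation_mono:
  "monotone_valuation m v \<Longrightarrow> A \<subseteq> B \<Longrightarrow> B \<subseteq> {1..m} \<Longrightarrow> v A \<le> v B"
  unfolding monotone_valuation_def by (meson Pow_iff mono_onD subset_trans)

text \<open>If some bundle is worth less than the share, the largest value \<open>t\<close> below the share is attained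
  and is not among the numbers whose minimum the share is, so that values up to \<open>t\<close> have
  probability below \<open>q\<close>.\<close>

lemma prob_ge_quantile_share:
  assumes q: "0 < q"
  shows "measure_pmf.prob (thinned_bundle c m n)
    {X \<in> Pow {1..m}. thinned_quantile_share c q m v n \<le> v X} > 1 - q"
proof -
  let ?M = "thinned_bundle c m n"
  let ?P = "measure_pmf.prob ?M"
  define T where "T = {t \<in> v ` Pow {1..m}. ?P {X. v X \<le> t} \<ge> q}"
  define \<tau> where "\<tau> = Min T"
  have finT: "finite T" by (simp add: T_def)
  define W where "W = {X \<in> Pow {1..m}. v X < \<tau>}"
  have finW: "finite W" by (simp add: W_def)
  have supp: "AE X in ?M. X \<subseteq> {1..m}"
    using set_pmf_thinned_bundle[of c m n] unfolding AE_measure_pmf_iff by blast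
  have "?P W < q"
  proof (cases "W = {}")
    case False
    define t where "t = Max (v ` W)"
    have t: "t \<in> v ` W" "\<And>X. X \<in> W \<Longrightarrow> v X \<le> t"
      using finW False unfolding t_def by (auto intro: Max_in)
    then have "t < \<tau>" by (auto simp: W_def)
    then have "t \<notin> T" using Min_le[OF finT, of t] unfolding \<tau>_def by linarith
    moreover have "t \<in> v ` Pow {1..m}" using t(1) by (auto simp: W_def)
    ultimately have "?P {X. v X \<le> t} < q" by (auto simp: T_def)
    moreover have "?P W \<le> ?P {X. v X \<le> t}"
      using t(2) by (intro measure_pmf.finite_measure_mono) auto
    ultimately show ?thesis by simp
  qed (use q in simp)
  moreover have "?P {X \<in> Pow {1..m}. \<tau> \<le> v X} = ?P (- W)"
    using supp by (intro measure_pmf.finite_measure_eq_AE) (auto simp: W_def)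
  moreover have "?P (- W) = 1 - ?P W"
    by (simp add: measure_pmf.prob_compl[symmetric] Compl_eq_Diff_UNIV)
  ultimately show ?thesis by (simp add: \<tau>_def T_def thinned_quantile_share_def)
qed

text \<open>The goods left over go to the first agent, which hurts nobody.\<close>

lemma allocation_extending_disjoint:
  assumes v: "\<And>i. i \<in> {1..n} \<Longrightarrow> monotone_valuation m (v i)" and "1 \<le> n"
    and S: "disjoint_family_on S {1..n}" "\<And>i. i \<in> {1..n} \<Longrightarrow> S i \<subseteq> {1..m}"
  shows "\<exists>S'. allocation m n S' \<and> (\<forall>i\<in>{1..n}. v i (S i) \<le> v i (S' i))"
proof -
  define R where "R = {1..m} - (\<Union>i\<in>{1..n}. S i)"
  define S' where "S' = S(1 := S 1 \<union> R)"
  have one: "1 \<in> {1..n}" using \<open>1 \<le> n\<close> by simp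
  have sub: "S i \<subseteq> S' i" "S' i \<subseteq> {1..m}" if "i \<in> {1..n}" for i
    using S(2)[OF that] unfolding S'_def R_def by auto
  have "disjoint_family_on S' {1..n}"
    unfolding disjoint_family_on_def
  proof (intro ballI impI)
    fix i j assume ij: "i \<in> {1..n}" "j \<in> {1..n}" "i \<noteq> j"
    have "S i \<inter> S j = {}" using S(1) ij unfolding disjoint_family_on_def by blast
    moreover have "R \<inter> S i = {}" "R \<inter> S j = {}" using ij unfolding R_def by blast+
    ultimately show "S' i \<inter> S' j = {}"
      using ij(3) by (cases "i = 1"; cases "j = 1") (auto simp: S'_def)
  qed
  moreover have "(\<Union>i\<in>{1..n}. S' i) = {1..m}"
  proof
    show "{1..m} \<subseteq> (\<Union>i\<in>{1..n}. S' i)"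
    proof
      fix x assume x: "x \<in> {1..m}"
      show "x \<in> (\<Union>i\<in>{1..n}. S' i)"
      proof (cases "x \<in> R")
        case True
        then have "x \<in> S' 1" by (simp add: S'_def)
        then show ?thesis using one by blast
      next
        case False
        then show ?thesis using x sub(1) unfolding R_def by blast
      qed
    qed
  qed (use sub(2) in blast)
  ultimately have "allocation m n S'" by (simp add: allocation_def)
  moreover have "v i (S i) \<le> v i (S' i)" if "i \<in> {1..n}" for i
    using monotone_valuation_mono[OF v[OF that]] sub[OF that] by blast
  ultimately show ?thesis by blast
qed

theorem theorem1p5:
  shows "\<exists>c::real. 0 < c \<and> c \<le> 1 \<and> universally_feasible (thinned_quantile_share c (exp (- c)))"
proof (intro exI conjI)
  let ?c = "1 / 480 :: real"
  show "universally_feasible (thinned_quantile_share ?c (exp (- ?c)))"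
    unfolding universally_feasible_def
  proof (intro allI impI)
    fix n m :: nat and v :: "nat \<Rightarrow> nat set \<Rightarrow> real"
    assume n: "2 \<le> n" and v: "\<forall>i\<in>{1..n}. monotone_valuation m (v i)"
    define \<tau> where "\<tau> i = thinned_quantile_share ?c (exp (- ?c)) m (v i) n" for i
    define F where "F i = {X \<in> Pow {1..m}. \<tau> i \<le> v i X}" for i
    have "rainbow {1..n} F"
    proof (rule rainbow_if_prob_gt[where c = ?c and n = n and m = m])
      fix i assume i: "i \<in> {1..n}"
      have mono: "v i A \<le> v i B" if "A \<subseteq> B" "B \<subseteq> {1..m}" for A B
        using v i monotone_valuation_mono that by blast
      show "up_closed {1..m} (F i)"
        unfolding up_closed_def
      proof (intro conjI ballI allI impI)
        fix A B assume A: "A \<in> F i" and B: "A \<subseteq> B \<and> B \<subseteq> {1..m}"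
        have "\<tau> i \<le> v i A" using A by (simp add: F_def)
        also have "\<dots> \<le> v i B" using B by (intro mono) auto
        finally show "B \<in> F i" using B by (simp add: F_def)
      qed (auto simp: F_def)
      show "1 - exp (- ?c) < measure_pmf.prob (thinned_bundle ?c m n) (F i)"
        unfolding F_def \<tau>_def by (intro prob_ge_quantile_share) simp
    qed auto
    then obtain S where S: "\<forall>i\<in>{1..n}. S i \<in> F i" "disjoint_family_on S {1..n}"
      unfolding rainbow_def by blast
    then have share: "S i \<subseteq> {1..m}" "\<tau> i \<le> v i (S i)" if "i \<in> {1..n}" for i
      using that unfolding F_def by blast+
    have "1 \<le> n" using n by simp
    then obtain S' where "allocation m n S'" "\<forall>i\<in>{1..n}. v i (S i) \<le> v i (S' i)"
      using allocation_extending_disjoint[OF _ _ S(2), of m v] v share(1) by blast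
    with share(2) show "\<exists>S. allocation m n S \<and> (\<forall>i\<in>{1..n}.
        thinned_quantile_share ?c (exp (- ?c)) m (v i) n \<le> v i (S i))"
      unfolding \<tau>_def by (meson order_trans)
  qed
qed auto

end
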